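(* For every integer $n\ge 2$, $$ \overline{SOME}(n)\ge \overline{SOME}(n-2). $$
   Context: An overpartition of a positive integer $n$ is a partition of $n$ in which the first occurrence of each part size may be overlined. $\overline{SOME}(n)$ is the sum of all odd parts minus the sum of all even parts, taken over all overpartitions of $n$ (parts counted with multiplicity, overlined or not), with $\overline{SOME}(0)=0$. *)

theory Defs
  imports Main "HOL-Library.Multiset"
begin

text \<open>An overpartition is encoded as the multiset of its parts together with the set of those
  part sizes whose first occurrence is overlined.\<close>

definition overpartitions :: "nat \<Rightarrow> (nat multiset \<times> nat set) set" where
  "overpartitions n =
     {(parts, over). 0 \<notin># parts \<and> sum_mset parts = n \<and> over \<subseteq> set_mset parts}"

definition SOME_bar :: "nat \<Rightarrow> int" where
  "SOME_bar n =
     (\<Sum>(parts, over)\<in>overpartitions n.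
        (\<Sum>p\<in>#filter_mset odd parts. int p) - (\<Sum>p\<in>#filter_mset even parts. int p))"

text \<open>The outer sum ranges over a finite set, so it is not zero by default.\<close>

lemma finite_overpartitions: "finite (overpartitions n)"
proof -
  have size_le: "size M \<le> sum_mset M" if "0 \<notin># M" for M :: "nat multiset"
    using that by (induction M) auto
  have fin_M: "finite {M :: nat multiset. 0 \<notin># M \<and> sum_mset M = n}"
  proof (rule finite_subset)
    show "{M :: nat multiset. 0 \<notin># M \<and> sum_mset M = n}
        \<subseteq> mset ` {xs. set xs \<subseteq> {..n} \<and> length xs \<le> n}"
    proof
      fix M :: "nat multiset"
      assume "M \<in> {M. 0 \<notin># M \<and> sum_mset M = n}"
      then have M: "0 \<notin># M" "sum_mset M = n" by auto
      obtain xs where xs: "M = mset xs" by (metis ex_mset)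
      have "set xs \<subseteq> {..n}"
        using M(2) member_le_sum_list[of _ xs] by (auto simp: xs sum_mset_sum_list)
      moreover have "length xs \<le> n"
        using size_le[OF M(1)] M(2) by (simp add: xs)
      ultimately show "M \<in> mset ` {xs. set xs \<subseteq> {..n} \<and> length xs \<le> n}"
        using xs by blast
    qed
    show "finite (mset ` {xs. set xs \<subseteq> {..n} \<and> length xs \<le> n})"
      by (intro finite_imageI finite_lists_length_le) simp
  qed
  have "overpartitions n = (SIGMA M:{M. 0 \<notin># M \<and> sum_mset M = n}. Pow (set_mset M))"
    by (auto simp: overpartitions_def)
  then show ?thesis using fin_M by (auto intro: finite_SigmaI)
qed

lemma SOME_bar_0: "SOME_bar 0 = 0"
proof -
  have "M = {#}" if "0 \<notin># M" "sum_mset M = 0" for M :: "nat multiset"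
    using that by (cases M) auto
  then have "overpartitions 0 = {({#}, {})}"
    by (auto simp: overpartitions_def)
  then show ?thesis by (simp add: SOME_bar_def)
qed

end

theory Submission
  imports Defs "HOL-Computational_Algebra.Formal_Power_Series"
begin

unbundle fps_syntax

text \<open>Write \<open>\<Phi>\<^sub>k = (1 + q^k) / (1 - q^k)\<close>, so that overpartitions are counted by \<open>P(q) = \<Prod>\<Phi>\<^sub>k\<close>.
  Summing the signed parts \<open>- (-1)^k k\<close> of size \<open>k\<close> replaces the factor \<open>\<Phi>\<^sub>k\<close> by
  \<open>- (-1)^k q \<Phi>\<^sub>k'\<close>, which is the effect of the logarithmic derivative of
  \<open>T(q) = 1 / P(-q)\<close>. Hence \<open>\<Sum>SOME(n) q^n = P(q) q T'(q) / T(q) = P(q) P(-q) q T'(q)\<close>.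
  In \<open>P(q) P(-q)\<close> the odd factors cancel and \<open>\<Prod>\<Phi>\<^sub>k^2\<close> over even \<open>k\<close> remains, while
  Gauss's identity gives \<open>T(q) = 1 + 2 \<Sum>q^(s^2)\<close>. Since \<open>(1 - q^2) \<Phi>\<^sub>2 = 1 + q^2\<close>,
  multiplication by \<open>1 - q^2\<close> leaves only nonnegative coefficients.\<close>

section \<open>A finite form of Gauss's identity for squares\<close>

text \<open>With \<open>v k\<close> inverse to \<open>1 - x ^ k\<close> this is
  \<open>(-1)^s (-1; x)_s / (x; x)_s\<close> in q-Pochhammer notation with base \<open>x\<close>.
  For \<open>s > 0\<close> the factor \<open>k = 0\<close> equals 2.\<close>

definition shanks_coeff :: "'a::comm_ring_1 \<Rightarrow> (nat \<Rightarrow> 'a) \<Rightarrow> nat \<Rightarrow> 'a" where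
  "shanks_coeff x v s = (-1) ^ s * (\<Prod>k<s. 1 + x ^ k) * (\<Prod>k=1..s. v k)"

lemma shanks_coeff_Suc:
  assumes "(1 - x ^ Suc s) * v (Suc s) = 1"
  shows "shanks_coeff x v (Suc s) * (1 - x ^ Suc s) = - (shanks_coeff x v s * (1 + x ^ s))"
proof -
  have "shanks_coeff x v (Suc s) * (1 - x ^ Suc s)
      = - (shanks_coeff x v s * (1 + x ^ s)) * ((1 - x ^ Suc s) * v (Suc s))"
    by (simp add: shanks_coeff_def power_Suc[of "-1"] mult_ac del: power_Suc)
  then show ?thesis by (simp only: assms mult_1_right)
qed

text \<open>By \<open>shanks_coeff_Suc\<close> each summand is an increment of the right side, which
  vanishes at \<open>m = 0\<close> because of \<open>1 - x ^ 0\<close>. With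
  \<open>y = x ^ Suc n\<close> these summands measure, up to a common factor, how the sum in
  \<open>shanks_identity\<close> changes from \<open>n\<close> to \<open>n + 1\<close>.\<close>

lemma shanks_telescope:
  assumes v: "\<And>k. k > 0 \<Longrightarrow> (1 - x ^ k) * v k = 1"
  shows "(\<Sum>s<m. shanks_coeff x v s * y ^ s * ((1 - y) * x ^ s - (1 + y)))
       = shanks_coeff x v m * (1 - x ^ m) * y ^ m"
proof (induction m)
  case (Suc m)
  have "shanks_coeff x v m * (1 - x ^ m) * y ^ m
      + shanks_coeff x v m * y ^ m * ((1 - y) * x ^ m - (1 + y))
      = - (shanks_coeff x v m * (1 + x ^ m)) * y ^ Suc m"
    by (simp add: algebra_simps)
  also have "\<dots> = shanks_coeff x v (Suc m) * (1 - x ^ Suc m) * y ^ Suc m"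
    by (simp only: shanks_coeff_Suc[where v = v, OF v[OF zero_less_Suc]])
  finally show ?case by (simp only: sum.lessThan_Suc Suc.IH)
qed simp

text \<open>Everything cancels except the sign and the factor \<open>1 + x ^ 0 = 2\<close>. This
  evaluates the boundary term of the telescoped sum.\<close>

lemma shanks_coeff_last:
  assumes u: "\<And>k. k > 0 \<Longrightarrow> (1 + x ^ k) * u k = 1"
    and v: "\<And>k. k > 0 \<Longrightarrow> (1 - x ^ k) * v k = 1"
  shows "(\<Prod>k=1..n. (1 - x ^ k) * u k) * (shanks_coeff x v (Suc n) * (1 - x ^ Suc n))
       = 2 * (-1) ^ Suc n"
proof (induction n)
  case 0
  have "shanks_coeff x v (Suc 0) * (1 - x ^ Suc 0) = - (shanks_coeff x v 0 * (1 + x ^ 0))"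
    by (rule shanks_coeff_Suc[where v = v, OF v[OF zero_less_Suc]])
  then show ?case by (simp add: shanks_coeff_def)
next
  case (Suc n)
  let ?p = "\<Prod>k=1..n. (1 - x ^ k) * u k"
  have "(\<Prod>k=1..Suc n. (1 - x ^ k) * u k)
          * (shanks_coeff x v (Suc (Suc n)) * (1 - x ^ Suc (Suc n)))
      = ?p * ((1 - x ^ Suc n) * u (Suc n))
          * - (shanks_coeff x v (Suc n) * (1 + x ^ Suc n))"
    unfolding shanks_coeff_Suc[where v = v, OF v[OF zero_less_Suc]] by (simp del: power_Suc)
  also have "\<dots> = - (?p * (shanks_coeff x v (Suc n) * (1 - x ^ Suc n)))
          * ((1 + x ^ Suc n) * u (Suc n))"
    by (simp only: mult_ac mult_minus_left mult_minus_right)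
  also have "\<dots> = 2 * (-1) ^ Suc (Suc n)"
    unfolding Suc.IH u[OF zero_less_Suc] by simp
  finally show ?case .
qed

text \<open>The summand \<open>s = 0\<close> is the product of Gauss's identity; the others are divisible by
  \<open>x ^ (n + 1)\<close>. The functions \<open>u\<close> and \<open>v\<close> stand for the inverses of \<open>1 + x ^ k\<close>
  and \<open>1 - x ^ k\<close>, so that no division is needed.\<close>

lemma shanks_identity:
  fixes x :: "'a::comm_ring_1"
  assumes u: "\<And>k. k > 0 \<Longrightarrow> (1 + x ^ k) * u k = 1"
    and v: "\<And>k. k > 0 \<Longrightarrow> (1 - x ^ k) * v k = 1"
  shows "(\<Sum>s\<le>n. (\<Prod>k=1..n. (1 - x ^ k) * u k) * shanks_coeff x v s * (x ^ Suc n) ^ s)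
       = 1 + 2 * (\<Sum>s=1..n. (-1) ^ s * x ^ (s\<^sup>2))"
proof (induction n)
  case 0
  show ?case by (simp add: shanks_coeff_def)
next
  case (Suc n)
  define c where "c = shanks_coeff x v"
  define p where "p = (\<Prod>k=1..n. (1 - x ^ k) * u k)"
  define y where "y = x ^ Suc n"
  define w where "w = u (Suc n)"
  have uw: "(1 + y) * w = 1"
    using u[of "Suc n"] by (simp add: y_def w_def)
  have xs: "(x ^ Suc (Suc n)) ^ s = x ^ s * y ^ s" for s
    by (simp add: y_def power_mult_distrib)
  \<comment> \<open>Inserting \<open>(1 + y) * w = 1\<close> into the old summand gives the old and
    the new one the common factor \<open>p * w\<close>; what remains of their difference
    telescopes.\<close>
  have term_diff: "p * ((1 - y) * w) * c s * (x ^ s * y ^ s)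
      = p * c s * y ^ s + p * w * (c s * y ^ s * ((1 - y) * x ^ s - (1 + y)))" for s
  proof -
    have "p * c s * y ^ s = p * c s * y ^ s * ((1 + y) * w)"
      by (simp add: uw)
    then show ?thesis by (simp add: algebra_simps)
  qed
  have prod_Suc: "(\<Prod>k=1..Suc n. (1 - x ^ k) * u k) = p * ((1 - y) * w)"
    by (simp add: p_def y_def w_def)
  have last: "p * (c (Suc n) * (1 - y)) = 2 * (-1) ^ Suc n"
    unfolding p_def c_def y_def by (rule shanks_coeff_last[OF u v])
  have pow: "y ^ Suc n = x ^ ((Suc n)\<^sup>2)"
    unfolding y_def power2_eq_square by (simp only: power_mult)
  have "(\<Sum>s\<le>Suc n. (\<Prod>k=1..Suc n. (1 - x ^ k) * u k) * c s * (x ^ Suc (Suc n)) ^ s)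
      = (\<Sum>s<Suc n. p * ((1 - y) * w) * c s * (x ^ s * y ^ s))
        + p * ((1 - y) * w) * c (Suc n) * (x ^ Suc n * y ^ Suc n)"
    unfolding prod_Suc xs by (simp only: sum.atMost_Suc lessThan_Suc_atMost)
  also have "(\<Sum>s<Suc n. p * ((1 - y) * w) * c s * (x ^ s * y ^ s))
      = (\<Sum>s<Suc n. p * c s * y ^ s)
        + p * w * (\<Sum>s<Suc n. c s * y ^ s * ((1 - y) * x ^ s - (1 + y)))"
    unfolding term_diff by (simp only: sum.distrib sum_distrib_left)
  also have "(\<Sum>s<Suc n. c s * y ^ s * ((1 - y) * x ^ s - (1 + y)))
      = c (Suc n) * (1 - y) * y ^ Suc n"
    unfolding c_def by (subst shanks_telescope[OF v]) (simp_all only: y_def)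
  \<comment> \<open>The boundary term and the new summand \<open>s = n + 1\<close> share
    \<open>p * w * c (Suc n) * (1 - y) * y ^ Suc n\<close>. The cofactors add up to
    \<open>1 + x ^ Suc n = 1 + y\<close>, which cancels \<open>w\<close>.\<close>
  also have "(\<Sum>s<Suc n. p * c s * y ^ s) + p * w * (c (Suc n) * (1 - y) * y ^ Suc n)
        + p * ((1 - y) * w) * c (Suc n) * (x ^ Suc n * y ^ Suc n)
      = (\<Sum>s<Suc n. p * c s * y ^ s) + p * (c (Suc n) * (1 - y)) * y ^ Suc n * ((1 + y) * w)"
    unfolding y_def[symmetric] by (simp only: algebra_simps mult_1_left mult_1_right)
  also have "\<dots> = (\<Sum>s<Suc n. p * c s * y ^ s) + 2 * (-1) ^ Suc n * x ^ ((Suc n)\<^sup>2)"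
    unfolding last uw pow by (simp only: mult_1_right)
  also have "(\<Sum>s<Suc n. p * c s * y ^ s) = 1 + 2 * (\<Sum>s=1..n. (-1) ^ s * x ^ (s\<^sup>2))"
    using Suc.IH unfolding p_def c_def y_def lessThan_Suc_atMost .
  finally show ?case
    unfolding c_def by (simp add: algebra_simps)
qed

section \<open>Generating functions\<close>

text \<open>The series \<open>\<Phi>\<^sub>k\<close>, entered by its coefficients: a positive number
  of copies of \<open>k\<close> admits two overlinings, no copies admit one.\<close>

definition over_fps :: "nat \<Rightarrow> rat fps" where
  "over_fps k = Abs_fps (\<lambda>i. if k dvd i then if i = 0 then 1 else 2 else 0)"

lemma over_fps_nth: "over_fps k $ i = (if k dvd i then if i = 0 then 1 else 2 else 0)"
  by (simp add: over_fps_def)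

lemma over_fps_mult:
  assumes "k > 0"
  shows "over_fps k * (1 - fps_X ^ k) = 1 + fps_X ^ k"
proof (rule fps_ext)
  fix i
  have "(over_fps k * (1 - fps_X ^ k)) $ i
      = over_fps k $ i - (if i < k then 0 else over_fps k $ (i - k))"
    by (simp add: right_diff_distrib fps_X_power_mult_right_nth)
  also have "\<dots> = (1 + fps_X ^ k :: rat fps) $ i"
    using assms dvd_imp_le[of k i]
    by (auto simp: over_fps_nth fps_X_power_nth dvd_minus_self)
  finally show "(over_fps k * (1 - fps_X ^ k)) $ i = (1 + fps_X ^ k :: rat fps) $ i" .
qed

text \<open>The \<open>k\<close>-th factor of \<open>T(q) = 1 / P(-q)\<close>: replacing
  \<open>q\<close> by \<open>-q\<close> inverts \<open>\<Phi>\<^sub>k\<close> for odd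
  \<open>k\<close> and fixes it for even \<open>k\<close>.\<close>

definition theta_fps :: "nat \<Rightarrow> rat fps" where
  "theta_fps k = (if odd k then over_fps k else inverse (over_fps k))"

lemma over_fps_inverse: "over_fps k * inverse (over_fps k) = 1"
  by (rule inverse_mult_eq_1') (simp add: over_fps_nth)

lemma theta_fps_nonzero: "theta_fps k \<noteq> 0"
proof
  assume "theta_fps k = 0"
  then have "theta_fps k $ 0 = 0" by simp
  then show False by (simp add: theta_fps_def over_fps_nth split: if_splits)
qed

lemma theta_fps_eq:
  assumes "k > 0"
  shows "theta_fps k = (1 - (- fps_X) ^ k) * inverse (1 + (- fps_X) ^ k)"
proof -
  have unit: "(1 + (- fps_X) ^ k) * inverse (1 + (- fps_X) ^ k :: rat fps) = 1"
    using assms by (intro inverse_mult_eq_1') (simp add: fps_power_zeroth zero_power)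
  have "theta_fps k * (1 + (- fps_X) ^ k) = 1 - (- fps_X) ^ k"
  proof (cases "odd k")
    case True
    then show ?thesis using over_fps_mult[OF assms] by (simp add: theta_fps_def)
  next
    case False
    have "inverse (over_fps k) * (1 + fps_X ^ k)
        = over_fps k * inverse (over_fps k) * (1 - fps_X ^ k)"
      unfolding over_fps_mult[OF assms, symmetric] by (simp only: mult_ac)
    then show ?thesis using False by (simp add: theta_fps_def over_fps_inverse)
  qed
  then have "theta_fps k * ((1 + (- fps_X) ^ k) * inverse (1 + (- fps_X) ^ k))
      = (1 - (- fps_X) ^ k) * inverse (1 + (- fps_X) ^ k)"
    by (metis mult.assoc)
  then show ?thesis by (simp add: unit)
qed

text \<open>For odd \<open>k\<close> the two series agree, for even \<open>k\<close> they are
  mutually inverse, so their logarithmic derivatives agree up to the sign that parts of size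
  \<open>k\<close> carry.\<close>

lemma over_theta_deriv:
  "(if odd k then 1 else - 1) * fps_deriv (over_fps k) * theta_fps k
     = over_fps k * fps_deriv (theta_fps k)"
proof (cases "odd k")
  case False
  have "fps_deriv (over_fps k * inverse (over_fps k)) = 0"
    by (simp add: over_fps_inverse)
  then show ?thesis using False by (simp add: theta_fps_def algebra_simps add_eq_0_iff)
qed (simp add: theta_fps_def)

text \<open>Apply \<open>shanks_identity\<close> at \<open>x = -q\<close>: through degree
  \<open>n\<close> only the summand \<open>s = 0\<close> survives, so the finite product already
  agrees there with \<open>1 + 2 \<Sum>q^(s^2)\<close>.\<close>

lemma theta_prod_nth_nonneg:
  assumes "i \<le> n"
  shows "(\<Prod>k=1..n. theta_fps k) $ i \<ge> 0"
proof -
  define x :: "rat fps" where "x = - fps_X"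
  define c where "c = shanks_coeff x (\<lambda>k. inverse (1 - x ^ k))"
  define p where "p = (\<Prod>k=1..n. theta_fps k)"
  have p: "p = (\<Prod>k=1..n. (1 - x ^ k) * inverse (1 + x ^ k))"
    unfolding p_def x_def by (intro prod.cong refl theta_fps_eq) auto
  have "(\<Sum>s\<le>n. p * c s * (x ^ Suc n) ^ s)
      = 1 + 2 * (\<Sum>s=1..n. (-1) ^ s * x ^ (s\<^sup>2))"
    unfolding p c_def
    by (intro shanks_identity inverse_mult_eq_1')
       (simp_all add: x_def fps_power_zeroth zero_power)
  then have eq: "p * c 0 + (\<Sum>s\<in>{..n} - {0}. p * c s * (x ^ Suc n) ^ s)
      = 1 + 2 * (\<Sum>s=1..n. (-1) ^ s * x ^ (s\<^sup>2))"
    by (subst (asm) sum.remove[of _ 0]) auto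
  have small: "(p * c s * (x ^ Suc n) ^ s) $ i = 0" if "s > 0" for s
  proof -
    have "(x ^ Suc n) ^ s = (-1) ^ (Suc n * s) * fps_X ^ (Suc n * s)"
      unfolding power_mult[symmetric] x_def by (rule power_minus)
    then have "p * c s * (x ^ Suc n) ^ s
        = p * c s * (-1) ^ (Suc n * s) * fps_X ^ (Suc n * s)"
      by (simp only: mult.assoc)
    moreover have "i < Suc n * s" using assms that by (cases s) auto
    ultimately show ?thesis by (simp only: fps_X_power_mult_right_nth if_True)
  qed
  have "(p * c 0) $ i
      = (p * c 0 + (\<Sum>s\<in>{..n} - {0}. p * c s * (x ^ Suc n) ^ s)) $ i"
    by (simp add: fps_sum_nth small del: power_Suc)
  also have "\<dots> = (1 + 2 * (\<Sum>s=1..n. (-1) ^ s * x ^ (s\<^sup>2))) $ i"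
    unfolding eq ..
  \<comment> \<open>The signs cancel because \<open>s\<close> and its square have the same
    parity.\<close>
  also have "(\<Sum>s=1..n. (-1) ^ s * x ^ (s\<^sup>2)) = (\<Sum>s=1..n. fps_X ^ (s\<^sup>2))"
  proof (intro sum.cong refl)
    fix s :: nat
    show "(-1) ^ s * x ^ (s\<^sup>2) = fps_X ^ (s\<^sup>2)"
      by (cases "even s") (simp_all add: x_def)
  qed
  also have "(1 + 2 * (\<Sum>s=1..n. fps_X ^ (s\<^sup>2) :: rat fps)) $ i
      = (if i = 0 then 1 else 0) + 2 * (\<Sum>s=1..n. if i = s\<^sup>2 then 1 else 0)"
    by (simp add: fps_sum_nth fps_X_power_nth numeral_fps_const)
  also have "\<dots> \<ge> 0" by (intro add_nonneg_nonneg mult_nonneg_nonneg sum_nonneg) auto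
  finally show ?thesis by (simp add: c_def shanks_coeff_def p_def)
qed

section \<open>Overpartitions with parts in a given set\<close>

definition msets_sum :: "nat set \<Rightarrow> nat \<Rightarrow> nat multiset set" where
  "msets_sum S n = {M. set_mset M \<subseteq> S \<and> sum_mset M = n}"

lemma msets_sum_empty: "msets_sum {} n = (if n = 0 then {{#}} else {})"
  by (auto simp: msets_sum_def)

lemma finite_msets_sum:
  assumes "0 \<notin> S"
  shows "finite (msets_sum S n)"
proof (rule finite_subset)
  show "msets_sum S n \<subseteq> fst ` overpartitions n"
  proof
    fix M assume "M \<in> msets_sum S n"
    then have "(M, {}) \<in> overpartitions n"
      using assms by (auto simp: msets_sum_def overpartitions_def)
    then show "M \<in> fst ` overpartitions n" by force
  qed
qed (simp add: finite_overpartitions)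

text \<open>Split off all copies of \<open>k\<close>; the index \<open>i\<close> is their total
  size. Padding with zeros where \<open>k\<close> does not divide \<open>i\<close> gives the shape
  of a Cauchy product.\<close>

lemma sum_msets_sum_insert:
  assumes "0 \<notin> S" "k \<notin> S" "k > 0"
  shows "(\<Sum>M\<in>msets_sum (insert k S) n. f M)
       = (\<Sum>i=0..n. if k dvd i
            then \<Sum>M\<in>msets_sum S (n - i). f (M + replicate_mset (i div k) k) else 0)"
proof -
  let ?I = "{i. i \<le> n \<and> k dvd i}"
  have sum_filter: "sum_mset M = sum_mset {#x \<in># M. x \<noteq> k#} + count M k * k" for M
  proof -
    have "M = {#x \<in># M. x \<noteq> k#} + replicate_mset (count M k) k"
      by (rule multiset_eqI) (auto simp: count_eq_zero_iff)
    then have "sum_mset M = sum_mset ({#x \<in># M. x \<noteq> k#} + replicate_mset (count M k) k)"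
      by (rule arg_cong)
    then show ?thesis by simp
  qed
  have "(\<Sum>M\<in>msets_sum (insert k S) n. f M)
      = (\<Sum>(i, M)\<in>(SIGMA i:?I. msets_sum S (n - i)). f (M + replicate_mset (i div k) k))"
  proof (rule sum.reindex_bij_witness[where
        i = "\<lambda>(i, M). M + replicate_mset (i div k) k"
        and j = "\<lambda>M. (count M k * k, {#x \<in># M. x \<noteq> k#})"])
    fix M assume "M \<in> msets_sum (insert k S) n"
    then show "(count M k * k, {#x \<in># M. x \<noteq> k#}) \<in> (SIGMA i:?I. msets_sum S (n - i))"
      using sum_filter[of M] by (auto simp: msets_sum_def)
  next
    fix M
    have "{#x \<in># M. x \<noteq> k#} + replicate_mset (count M k) k = M"
      by (rule multiset_eqI) (auto simp: count_eq_zero_iff)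
    then show "(case (count M k * k, {#x \<in># M. x \<noteq> k#}) of
        (i, M) \<Rightarrow> M + replicate_mset (i div k) k) = M"
      and "(case (count M k * k, {#x \<in># M. x \<noteq> k#}) of
        (i, M) \<Rightarrow> f (M + replicate_mset (i div k) k)) = f M"
      using assms(3) by simp_all
  next
    fix b assume b: "b \<in> (SIGMA i:?I. msets_sum S (n - i))"
    obtain i M where iM: "b = (i, M)" by (cases b)
    have "count M k = 0" "{#x \<in># M. x \<noteq> k#} = M"
      using b assms(2)
      by (auto simp: iM msets_sum_def count_eq_zero_iff filter_mset_eq_conv)
    then show "(count (case b of (i, M) \<Rightarrow> M + replicate_mset (i div k) k) k * k,
        {#x \<in># case b of (i, M) \<Rightarrow> M + replicate_mset (i div k) k. x \<noteq> k#}) = b"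
      using b by (auto simp: iM)
    show "(case b of (i, M) \<Rightarrow> M + replicate_mset (i div k) k) \<in> msets_sum (insert k S) n"
      using b by (auto simp: iM msets_sum_def split: if_splits)
  qed
  also have "\<dots> = (\<Sum>i\<in>?I. \<Sum>M\<in>msets_sum S (n - i). f (M + replicate_mset (i div k) k))"
    by (rule sum.Sigma[symmetric]) (auto intro: finite_msets_sum[OF assms(1)])
  also have "?I = {i\<in>{0..n}. k dvd i}" by auto
  finally show ?thesis by (simp only: sum.inter_filter[OF finite_atLeastAtMost])
qed

definition SOME_weight :: "nat multiset \<Rightarrow> int" where
  "SOME_weight M = (\<Sum>p\<in>#filter_mset odd M. int p) - (\<Sum>p\<in>#filter_mset even M. int p)"

text \<open>A multiset with \<open>d\<close> distinct part sizes carries \<open>2 ^ d\<close>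
  choices of overlines, so this counts overpartitions with parts in \<open>S\<close>.\<close>

definition count_fps :: "nat set \<Rightarrow> rat fps" where
  "count_fps S = Abs_fps (\<lambda>n. \<Sum>M\<in>msets_sum S n. 2 ^ card (set_mset M))"

definition SOME_fps :: "nat set \<Rightarrow> rat fps" where
  "SOME_fps S =
     Abs_fps (\<lambda>n. \<Sum>M\<in>msets_sum S n. 2 ^ card (set_mset M) * of_int (SOME_weight M))"

lemma SOME_weight_add_replicate:
  "SOME_weight (M + replicate_mset m k)
     = SOME_weight M + (if odd k then 1 else - 1) * int (m * k)"
  by (induction m) (simp_all add: SOME_weight_def algebra_simps)

lemma two_power_card_add_replicate:
  assumes "k \<notin># M" "k > 0" "k dvd i"
  shows "(2::rat) ^ card (set_mset (M + replicate_mset (i div k) k))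
       = over_fps k $ i * 2 ^ card (set_mset M)"
proof (cases "i = 0")
  case False
  then have "i div k \<noteq> 0" using assms by (auto simp: dvd_div_eq_0_iff)
  then show ?thesis using False assms by (simp add: over_fps_nth)
qed (simp add: over_fps_nth)

lemma not_in_msets_sum: "M \<in> msets_sum S n \<Longrightarrow> k \<notin> S \<Longrightarrow> k \<notin># M"
  by (auto simp: msets_sum_def)

lemma count_fps_insert:
  assumes "0 \<notin> S" "k \<notin> S" "k > 0"
  shows "count_fps (insert k S) = over_fps k * count_fps S"
proof (rule fps_ext)
  fix n
  have "count_fps (insert k S) $ n = (\<Sum>i=0..n. if k dvd i
      then \<Sum>M\<in>msets_sum S (n - i). 2 ^ card (set_mset (M + replicate_mset (i div k) k))
      else 0)"
    unfolding count_fps_def fps_nth_Abs_fps by (rule sum_msets_sum_insert[OF assms])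
  also have "\<dots> = (\<Sum>i=0..n. over_fps k $ i * count_fps S $ (n - i))"
  proof (intro sum.cong refl)
    fix i
    show "(if k dvd i
        then \<Sum>M\<in>msets_sum S (n - i). 2 ^ card (set_mset (M + replicate_mset (i div k) k))
        else 0) = over_fps k $ i * count_fps S $ (n - i)"
      unfolding count_fps_def fps_nth_Abs_fps sum_distrib_left
      using assms
      by (auto intro!: sum.cong two_power_card_add_replicate simp: not_in_msets_sum
          simp del: set_mset_union set_mset_replicate_mset_subset)
         (simp add: over_fps_nth)
  qed
  finally show "count_fps (insert k S) $ n = (over_fps k * count_fps S) $ n"
    by (simp add: fps_mult_nth)
qed

text \<open>The weight is additive, and copies of \<open>k\<close> of total size \<open>i\<close>
  contribute \<open>i\<close> up to sign. The operator \<open>q d/dq\<close> supplies this factor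
  \<open>i\<close> on coefficients.\<close>

lemma SOME_fps_insert:
  assumes "0 \<notin> S" "k \<notin> S" "k > 0"
  shows "SOME_fps (insert k S) = over_fps k * SOME_fps S
    + (if odd k then 1 else - 1) * (fps_X * fps_deriv (over_fps k)) * count_fps S"
    (is "_ = _ + ?e * ?D * _")
proof (rule fps_ext)
  fix n
  define e :: rat where "e = (if odd k then 1 else - 1)"
  have e: "?e * ?D * count_fps S = fps_const e * (?D * count_fps S)"
    by (simp add: e_def mult.assoc flip: fps_const_neg)
  have D: "?D $ i = of_nat i * over_fps k $ i" for i
    by (cases i) simp_all
  have "SOME_fps (insert k S) $ n = (\<Sum>i=0..n. if k dvd i
      then \<Sum>M\<in>msets_sum S (n - i). 2 ^ card (set_mset (M + replicate_mset (i div k) k))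
        * of_int (SOME_weight (M + replicate_mset (i div k) k))
      else 0)"
    unfolding SOME_fps_def fps_nth_Abs_fps by (rule sum_msets_sum_insert[OF assms])
  also have "\<dots> = (\<Sum>i=0..n. over_fps k $ i * SOME_fps S $ (n - i)
      + e * (?D $ i * count_fps S $ (n - i)))"
  proof (intro sum.cong refl)
    fix i
    show "(if k dvd i
        then \<Sum>M\<in>msets_sum S (n - i). 2 ^ card (set_mset (M + replicate_mset (i div k) k))
          * of_int (SOME_weight (M + replicate_mset (i div k) k))
        else 0)
      = over_fps k $ i * SOME_fps S $ (n - i) + e * (?D $ i * count_fps S $ (n - i))"
    proof (cases "k dvd i")
      case True
      have "2 ^ card (set_mset (M + replicate_mset (i div k) k))
          * of_int (SOME_weight (M + replicate_mset (i div k) k))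
        = over_fps k $ i * (2 ^ card (set_mset M) * of_int (SOME_weight M))
          + e * (of_nat i * over_fps k $ i * 2 ^ card (set_mset M))"
        if "M \<in> msets_sum S (n - i)" for M
        unfolding two_power_card_add_replicate[OF not_in_msets_sum[OF that assms(2)] assms(3) True]
          SOME_weight_add_replicate
        using True by (simp add: e_def algebra_simps)
      then show ?thesis
        using True unfolding SOME_fps_def count_fps_def fps_nth_Abs_fps D
        by (simp add: sum.distrib sum_distrib_left)
    next
      case False
      then have "over_fps k $ i = 0" by (simp add: over_fps_nth)
      then show ?thesis using False by (simp only: D if_False mult_zero_left mult_zero_right add_0)
    qed
  qed
  also have "\<dots> = (over_fps k * SOME_fps S + fps_const e * (?D * count_fps S)) $ n"
    by (simp only: sum.distrib fps_add_nth fps_mult_left_const_nth sum_distrib_left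
        fps_mult_nth[of "over_fps k"] fps_mult_nth[of ?D])
  finally show "SOME_fps (insert k S) $ n
      = (over_fps k * SOME_fps S + ?e * ?D * count_fps S) $ n"
    unfolding e .
qed

text \<open>Adjoining \<open>k\<close> adds the signed logarithmic derivative of
  \<open>over_fps k\<close>, which \<open>over_theta_deriv\<close> turns into that of
  \<open>theta_fps k\<close>; the Leibniz rule reassembles the product. Denominators are cleared
  throughout.\<close>

lemma SOME_fps_theta:
  assumes "finite S" "0 \<notin> S"
  shows "SOME_fps S * (\<Prod>k\<in>S. theta_fps k)
       = count_fps S * (fps_X * fps_deriv (\<Prod>k\<in>S. theta_fps k))"
  using assms
proof (induction S rule: finite_induct)
  case empty
  have "SOME_fps {} = 0"
    by (rule fps_ext) (simp add: SOME_fps_def msets_sum_empty SOME_weight_def)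
  then show ?case by simp
next
  case (insert k S)
  define T where "T = (\<Prod>k\<in>S. theta_fps k)"
  define e :: "rat fps" where "e = (if odd k then 1 else - 1)"
  have IH: "SOME_fps S * T = count_fps S * (fps_X * fps_deriv T)"
    using insert unfolding T_def by simp
  have loc: "e * fps_deriv (over_fps k) * theta_fps k = over_fps k * fps_deriv (theta_fps k)"
    unfolding e_def by (rule over_theta_deriv)
  have "(over_fps k * SOME_fps S + e * (fps_X * fps_deriv (over_fps k)) * count_fps S)
        * (theta_fps k * T)
      = over_fps k * theta_fps k * (SOME_fps S * T)
        + count_fps S * fps_X * T * (e * fps_deriv (over_fps k) * theta_fps k)"
    by (simp only: algebra_simps)
  also have "\<dots> = over_fps k * count_fps S * (fps_X * fps_deriv (theta_fps k * T))"
    unfolding IH loc by (simp add: algebra_simps)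
  finally show ?case
    using insert by (simp add: SOME_fps_insert count_fps_insert T_def e_def)
qed

text \<open>Factor by factor, \<open>over_fps k\<close> is \<open>theta_fps k\<close> for odd
  \<open>k\<close> and \<open>theta_fps k * (over_fps k)^2\<close> for even
  \<open>k\<close>.\<close>

lemma count_fps_theta:
  assumes "finite S" "0 \<notin> S"
  shows "count_fps S = (\<Prod>k\<in>S. theta_fps k) * (\<Prod>k\<in>{k\<in>S. even k}. (over_fps k)\<^sup>2)"
proof -
  have "count_fps S = (\<Prod>k\<in>S. over_fps k)"
    using assms
  proof (induction S rule: finite_induct)
    case empty
    show ?case by (rule fps_ext) (simp add: count_fps_def msets_sum_empty)
  qed (simp add: count_fps_insert)
  also have "\<dots> = (\<Prod>k\<in>S. theta_fps k * (if even k then (over_fps k)\<^sup>2 else 1))"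
    by (intro prod.cong refl)
       (simp add: theta_fps_def power2_eq_square mult.commute[of "inverse _"] mult.assoc
          over_fps_inverse)
  finally show ?thesis
    using assms(1) by (simp add: prod.distrib prod.inter_filter)
qed

text \<open>Substitute \<open>count_fps_theta\<close> into \<open>SOME_fps_theta\<close> and cancel
  the nonzero theta product in the integral domain of rational power series.\<close>

lemma SOME_fps_eq:
  assumes "finite S" "0 \<notin> S"
  shows "SOME_fps S = (\<Prod>k\<in>{k\<in>S. even k}. (over_fps k)\<^sup>2)
    * (fps_X * fps_deriv (\<Prod>k\<in>S. theta_fps k))"
proof -
  have "(\<Prod>k\<in>S. theta_fps k) \<noteq> 0"
    using assms(1) theta_fps_nonzero by (simp add: prod_zero_iff)
  moreover have "(\<Prod>k\<in>S. theta_fps k) * SOME_fps S = (\<Prod>k\<in>S. theta_fps k)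
      * ((\<Prod>k\<in>{k\<in>S. even k}. (over_fps k)\<^sup>2) * (fps_X * fps_deriv (\<Prod>k\<in>S. theta_fps k)))"
    using SOME_fps_theta[OF assms] count_fps_theta[OF assms] by (simp only: mult_ac)
  ultimately show ?thesis by (simp only: mult_cancel_left) simp
qed

text \<open>Parts of an overpartition of \<open>n\<close> are at most \<open>n\<close>, so sizes up
  to \<open>N\<close> suffice. Thus a single finite set of sizes serves both \<open>n\<close> and
  \<open>n - 2\<close> in the theorem.\<close>

lemma SOME_bar_eq_nth:
  assumes "n \<le> N"
  shows "of_int (SOME_bar n) = SOME_fps {1..N} $ n"
proof -
  have "p \<le> N" if "p \<in># M" "sum_mset M = n" for p M
    using that assms by (auto dest!: multi_member_split)
  then have "overpartitions n = (SIGMA M:msets_sum {1..N} n. Pow (set_mset M))"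
    by (auto simp: overpartitions_def msets_sum_def not_less_eq_eq Suc_le_eq intro!: Nat.gr0I)
  then have "SOME_bar n
      = (\<Sum>(M, A)\<in>(SIGMA M:msets_sum {1..N} n. Pow (set_mset M)). SOME_weight M)"
    by (simp only: SOME_bar_def SOME_weight_def)
  also have "\<dots> = (\<Sum>M\<in>msets_sum {1..N} n. \<Sum>A\<in>Pow (set_mset M). SOME_weight M)"
    by (rule sum.Sigma[symmetric]) (auto intro: finite_msets_sum)
  also have "\<dots> = (\<Sum>M\<in>msets_sum {1..N} n. 2 ^ card (set_mset M) * SOME_weight M)"
    by (simp add: card_Pow)
  finally show ?thesis by (simp add: SOME_fps_def)
qed

section \<open>Nonnegativity\<close>

lemma fps_mult_nth_nonneg:
  fixes f g :: "'a::linordered_semidom fps"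
  assumes "\<And>i. i \<le> n \<Longrightarrow> f $ i \<ge> 0" "\<And>i. i \<le> n \<Longrightarrow> g $ i \<ge> 0"
  shows "(f * g) $ n \<ge> 0"
  unfolding fps_mult_nth using assms by (intro sum_nonneg mult_nonneg_nonneg) auto

lemma fps_prod_nth_nonneg:
  fixes f :: "'b \<Rightarrow> 'a::linordered_semidom fps"
  assumes "\<And>k i. k \<in> S \<Longrightarrow> f k $ i \<ge> 0"
  shows "(\<Prod>k\<in>S. f k) $ n \<ge> 0"
  using assms
  by (induction S arbitrary: n rule: infinite_finite_induct)
     (auto intro: fps_mult_nth_nonneg)

lemma over_fps_sq_nth_nonneg: "(over_fps k)\<^sup>2 $ i \<ge> 0"
  unfolding power2_eq_square by (rule fps_mult_nth_nonneg) (simp_all add: over_fps_nth)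

theorem theorem3p12:
  fixes n :: nat
  assumes "n \<ge> 2"
  shows "SOME_bar n \<ge> SOME_bar (n - 2)"
proof -
  define E where "E = (\<Prod>k\<in>{k\<in>{1..n}. even k} - {2}. (over_fps k)\<^sup>2)"
  define D where "D = fps_X * fps_deriv (\<Prod>k=1..n. theta_fps k)"
  have split: "(\<Prod>k\<in>{k\<in>{1..n}. even k}. (over_fps k)\<^sup>2) = (over_fps 2)\<^sup>2 * E"
    unfolding E_def using assms by (intro prod.remove) auto
  have "SOME_fps {1..n} = (over_fps 2)\<^sup>2 * E * D"
    using SOME_fps_eq[of "{1..n}"] unfolding split D_def by simp
  \<comment> \<open>One of the two factors \<open>over_fps 2\<close> absorbs \<open>1 - q^2\<close>
    and becomes \<open>1 + q^2\<close>; the other stays.\<close>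
  then have "(1 - fps_X ^ 2) * SOME_fps {1..n}
      = over_fps 2 * (over_fps 2 * (1 - fps_X ^ 2)) * E * D"
    by (simp only: power2_eq_square[of "over_fps 2"] mult_ac)
  also have "\<dots> = over_fps 2 * (1 + fps_X ^ 2) * E * D"
    by (subst over_fps_mult) simp_all
  finally have eq: "(1 - fps_X ^ 2) * SOME_fps {1..n} = over_fps 2 * (1 + fps_X ^ 2) * E * D" .
  \<comment> \<open>Coefficient \<open>i\<close> of \<open>D\<close> is \<open>i\<close> times that
    of the theta product, whose sign is known only through degree \<open>n\<close>. This is enough
    for the coefficient at \<open>n\<close>.\<close>
  have "D $ i \<ge> 0" if "i \<le> n" for i
    using theta_prod_nth_nonneg[OF that] by (cases i) (simp_all add: D_def)
  then have "(over_fps 2 * (1 + fps_X ^ 2) * E * D) $ n \<ge> 0"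
    by (intro fps_mult_nth_nonneg)
       (simp_all add: over_fps_nth fps_X_power_nth E_def fps_prod_nth_nonneg over_fps_sq_nth_nonneg)
  then have "SOME_fps {1..n} $ n - SOME_fps {1..n} $ (n - 2) \<ge> 0"
    using assms unfolding eq[symmetric] left_diff_distrib
    by (simp add: fps_X_power_mult_nth)
  then show ?thesis
    using SOME_bar_eq_nth[of n n] SOME_bar_eq_nth[of "n - 2" n] by simp
qed

end
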